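(* Let $G$ be a finite simple graph. If $\emptyset\neq\Gamma'\subseteq\mathrm{MaxCritIndep}(G)$ and $\emptyset\neq\Gamma\subseteq\Omega(G)$, then \[ \left|\bigcap\Gamma'\right|+\left|\bigcup\Gamma'\right|\leq 2\alpha'(G)\leq 2\alpha(G)\leq\left|\bigcap\Gamma\right|+\left|\bigcup\Gamma\right|. \]
   Context: For a graph $G$ and $A\subseteq V(G)$: $N(A)=\{v\in V(G): v \text{ has a neighbor in } A\}$. A set is independent if no two of its vertices are adjacent; $\mathrm{Ind}(G)$ is the family of independent sets, $\alpha(G)$ the maximum size of an independent set, and $\Omega(G)$ the family of all maximum independent sets. The difference of $X\subseteq V(G)$ is $d(X)=|X|-|N(X)|$. An independent set $A$ is critical if $d(A)=\max\{d(I):I\in\mathrm{Ind}(G)\}$. A maximum critical independent set is a critical independent set of maximum cardinality among all critical independent sets; $\mathrm{MaxCritIndep}(G)$ denotes the family of all of them. The critical independence number $\alpha'(G)$ is the maximum cardinality of a critical independent set of $G$. *)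

theory Defs
  imports "Graph_Theory.Digraph"
begin

text \<open>
  Finite simple graphs are those of the locale \<^locale>\<open>graph\<close>: finite, loop-free digraphs without
  parallel arcs whose adjacency relation \<open>u \<rightarrow>\<^bsub>G\<^esub> v\<close> is symmetric. The null graph is allowed.
\<close>

definition neighborhood :: "('a, 'b) pre_digraph \<Rightarrow> 'a set \<Rightarrow> 'a set" where
  "neighborhood G A = {v \<in> verts G. \<exists>u\<in>A. v \<rightarrow>\<^bsub>G\<^esub> u}"

definition Ind :: "('a, 'b) pre_digraph \<Rightarrow> 'a set set" where
  "Ind G = {S. S \<subseteq> verts G \<and> (\<forall>u\<in>S. \<forall>v\<in>S. \<not> u \<rightarrow>\<^bsub>G\<^esub> v)}"

definition indep_number :: "('a, 'b) pre_digraph \<Rightarrow> nat" where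
  "indep_number G = Max (card ` Ind G)"

definition Max_Ind :: "('a, 'b) pre_digraph \<Rightarrow> 'a set set" where
  "Max_Ind G = {S \<in> Ind G. \<forall>T\<in>Ind G. card T \<le> card S}"

text \<open>The difference can be negative, hence it is integer-valued.\<close>

definition difference :: "('a, 'b) pre_digraph \<Rightarrow> 'a set \<Rightarrow> int" where
  "difference G X = int (card X) - int (card (neighborhood G X))"

definition Crit_Ind :: "('a, 'b) pre_digraph \<Rightarrow> 'a set set" where
  "Crit_Ind G = {A \<in> Ind G. difference G A = Max (difference G ` Ind G)}"

definition Max_Crit_Ind :: "('a, 'b) pre_digraph \<Rightarrow> 'a set set" where
  "Max_Crit_Ind G = {A \<in> Crit_Ind G. \<forall>B\<in>Crit_Ind G. card B \<le> card A}"

definition crit_indep_number :: "('a, 'b) pre_digraph \<Rightarrow> nat" where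
  "crit_indep_number G = Max (card ` Crit_Ind G)"

end

theory Submission
  imports Defs
begin

text \<open>
  For maximum independent sets, replace the part of a set \<open>T\<close> outside the union of the others by
  the intersection of the others: the result is independent, so \<open>T\<close> is at least as large, and the
  lower bound follows by adding the sets one at a time.

  For critical sets, the key is the Hall-type inequality \<open>|Y| \<le> |A \<inter> N(Y)|\<close> for \<open>Y \<subseteq> N(A)\<close>: otherwise
  deleting \<open>N(Y)\<close> from \<open>A\<close> would increase the difference. Together with the supermodularity of the
  difference it shows that \<open>A \<union> (B - N(A))\<close> is critical whenever \<open>A\<close> and \<open>B\<close> are. If \<open>A\<close> is moreover
  maximum, then \<open>B \<subseteq> A \<union> N(A)\<close>, and the Hall-type inequality for \<open>Y = \<Union>\<Gamma>' - A\<close> gives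
  \<open>|\<Union>\<Gamma>' - A| \<le> |A - \<Inter>\<Gamma>'|\<close>.
\<close>

context graph
begin

lemma Ind_subset_verts: "S \<in> Ind G \<Longrightarrow> S \<subseteq> verts G"
  by (simp add: Ind_def)

lemma finite_Ind_member: "S \<in> Ind G \<Longrightarrow> finite S"
  using Ind_subset_verts finite_subset finite_verts by blast

lemma finite_Ind: "finite (Ind G)"
  by (rule finite_subset[of _ "Pow (verts G)"]) (auto simp: Ind_def)

lemma empty_in_Ind: "{} \<in> Ind G"
  by (simp add: Ind_def)

lemma Ind_subset: "S \<in> Ind G \<Longrightarrow> T \<subseteq> S \<Longrightarrow> T \<in> Ind G"
  unfolding Ind_def by blast

lemma finite_neighborhood: "finite (neighborhood G A)"
  by (simp add: neighborhood_def)

lemma indep_number_eq_card: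
  assumes "S \<in> Max_Ind G"
  shows "indep_number G = card S"
  unfolding indep_number_def
  using assms finite_Ind by (intro Max_eqI) (auto simp: Max_Ind_def)

lemma Crit_Ind_iff:
  "A \<in> Crit_Ind G \<longleftrightarrow> A \<in> Ind G \<and> (\<forall>B\<in>Ind G. difference G B \<le> difference G A)"
proof -
  have "finite (difference G ` Ind G)" "difference G ` Ind G \<noteq> {}"
    using finite_Ind empty_in_Ind by auto
  then show ?thesis
    unfolding Crit_Ind_def by (auto simp: eq_Max_iff)
qed

lemma finite_Crit_Ind: "finite (Crit_Ind G)"
  by (rule finite_subset[OF _ finite_Ind]) (auto simp: Crit_Ind_def)

lemma crit_indep_number_eq_card:
  assumes "A \<in> Max_Crit_Ind G"
  shows "crit_indep_number G = card A"
  unfolding crit_indep_number_def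
  using assms finite_Crit_Ind by (intro Max_eqI) (auto simp: Max_Crit_Ind_def)

text \<open>No vertex of \<open>Y\<close> has a neighbor left in
  \<open>A - neighborhood G Y\<close>. The deletion thus costs |A \<inter> N(Y)| vertices of
  \<open>A\<close> but removes all of \<open>Y\<close> from its neighborhood.\<close>

lemma difference_diff_neighborhood:
  assumes "A \<in> Ind G" "Y \<subseteq> neighborhood G A"
  shows "difference G (A - neighborhood G Y)
    \<ge> difference G A + int (card Y) - int (card (A \<inter> neighborhood G Y))"
proof -
  have "neighborhood G (A - neighborhood G Y) \<subseteq> neighborhood G A - Y"
    using Ind_subset_verts[OF assms(1)] arcs_ends_symmetric[OF sym_arcs]
    unfolding neighborhood_def by blast
  then have "card (neighborhood G (A - neighborhood G Y)) \<le> card (neighborhood G A - Y)"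
    by (simp add: card_mono finite_neighborhood)
  also have "\<dots> = card (neighborhood G A) - card Y"
    using assms(2) by (meson card_Diff_subset finite_neighborhood finite_subset)
  finally have "card (neighborhood G (A - neighborhood G Y)) + card Y \<le> card (neighborhood G A)"
    using card_mono[OF finite_neighborhood assms(2)] by linarith
  moreover have "card A = card (A - neighborhood G Y) + card (A \<inter> neighborhood G Y)"
    using card_Int_Diff[OF finite_Ind_member[OF assms(1)], of "neighborhood G Y"] by simp
  ultimately show ?thesis
    unfolding difference_def by linarith
qed

lemma critical_Hall:
  assumes "A \<in> Crit_Ind G" "Y \<subseteq> neighborhood G A"
  shows "card Y \<le> card (A \<inter> neighborhood G Y)"
proof -
  have A: "A \<in> Ind G"
    using assms(1) by (simp add: Crit_Ind_iff)
  have "difference G (A - neighborhood G Y) \<le> difference G A"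
    using assms(1) Ind_subset[OF A] by (simp add: Crit_Ind_iff)
  then show ?thesis
    using difference_diff_neighborhood[OF A assms(2)] by linarith
qed

text \<open>Cardinality is modular and N(A \<union> B) = N(A) \<union> N(B), whereas N(A \<inter> B)
  is merely contained in N(A) \<inter> N(B).\<close>

lemma difference_supermodular:
  assumes "finite A" "finite B"
  shows "difference G A + difference G B \<le> difference G (A \<union> B) + difference G (A \<inter> B)"
proof -
  have Un: "neighborhood G (A \<union> B) = neighborhood G A \<union> neighborhood G B"
    by (auto simp: neighborhood_def)
  have "card (neighborhood G (A \<inter> B)) \<le> card (neighborhood G A \<inter> neighborhood G B)"
    by (rule card_mono) (auto simp: neighborhood_def)
  then show ?thesis
    using card_Un_Int[OF assms] card_Un_Int[OF finite_neighborhood finite_neighborhood, of A B]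
    unfolding difference_def Un by linarith
qed

lemma Crit_Ind_Un_diff_neighborhood:
  assumes "A \<in> Crit_Ind G" "B \<in> Crit_Ind G"
  shows "A \<union> (B - neighborhood G A) \<in> Crit_Ind G"
proof -
  have A: "A \<in> Ind G" and B: "B \<in> Ind G"
    using assms by (auto simp: Crit_Ind_iff)
  \<comment> \<open>With this choice, deleting N(Y) from \<open>B\<close> is the same as deleting
    N(A), so the deletion bound for \<open>B\<close> loses |B \<inter> N(A)| and gains |Y|.\<close>
  define Y where "Y = A \<inter> neighborhood G B"
  have BY: "B \<inter> neighborhood G Y = B \<inter> neighborhood G A"
    using Ind_subset_verts[OF A] Ind_subset_verts[OF B] arcs_ends_symmetric[OF sym_arcs]
    unfolding Y_def neighborhood_def by blast
  \<comment> \<open>The Hall-type inequality for \<open>A\<close> shows that the gain covers the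
    loss.\<close>
  have "card (B \<inter> neighborhood G A) \<le> card (A \<inter> neighborhood G (B \<inter> neighborhood G A))"
    by (rule critical_Hall[OF assms(1)]) auto
  also have "\<dots> \<le> card Y"
    unfolding Y_def by (rule card_mono) (auto simp: neighborhood_def)
  finally have BY_le: "difference G B \<le> difference G (B - neighborhood G Y)"
    using difference_diff_neighborhood[OF B, of Y] BY by (simp add: Y_def)
  have D: "difference G A \<le> difference G (B - neighborhood G A)"
  proof -
    have "difference G A \<le> difference G B"
      using assms(2) A by (simp add: Crit_Ind_iff)
    moreover have "B - neighborhood G Y = B - neighborhood G A"
      using BY by blast
    ultimately show ?thesis
      using BY_le by simp
  qed
  \<comment> \<open>The intersection is independent, so its difference cancels against that of
    \<open>A\<close> in the supermodular inequality; the union keeps at least the difference of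
    \<open>B - neighborhood G A\<close>.\<close>
  have "difference G (A \<inter> (B - neighborhood G A)) \<le> difference G A"
    using assms(1) Ind_subset[OF A, of "A \<inter> (B - neighborhood G A)"]
    by (auto simp: Crit_Ind_iff)
  moreover have "difference G A + difference G (B - neighborhood G A)
      \<le> difference G (A \<union> (B - neighborhood G A)) + difference G (A \<inter> (B - neighborhood G A))"
    using A B by (intro difference_supermodular) (auto simp: finite_Ind_member)
  ultimately have "difference G A \<le> difference G (A \<union> (B - neighborhood G A))"
    using D by linarith
  moreover have "A \<union> (B - neighborhood G A) \<in> Ind G"
    using A B arcs_ends_symmetric[OF sym_arcs] unfolding Ind_def neighborhood_def by blast
  ultimately show ?thesis
    using assms(1) unfolding Crit_Ind_iff by (meson order_trans)
qed

text \<open>A vertex of \<open>B\<close> outside would make the critical set \<open>?C\<close>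
  larger than \<open>A\<close>.\<close>

lemma Crit_Ind_subset_closed_neighborhood:
  assumes "A \<in> Max_Crit_Ind G" "B \<in> Crit_Ind G"
  shows "B \<subseteq> A \<union> neighborhood G A"
proof -
  let ?C = "A \<union> (B - neighborhood G A)"
  have "?C \<in> Crit_Ind G"
    using assms by (intro Crit_Ind_Un_diff_neighborhood) (auto simp: Max_Crit_Ind_def)
  then have "card ?C \<le> card A" "finite ?C"
    using assms(1) by (auto simp: Max_Crit_Ind_def Crit_Ind_iff dest: finite_Ind_member)
  then have "A = ?C"
    by (intro card_seteq) auto
  then show ?thesis
    by blast
qed

lemma card_Inter_Union_Max_Crit_Ind:
  assumes "\<Gamma> \<noteq> {}" "\<Gamma> \<subseteq> Max_Crit_Ind G"
  shows "card (\<Inter>\<Gamma>) + card (\<Union>\<Gamma>) \<le> 2 * crit_indep_number G"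
proof -
  obtain A where A: "A \<in> \<Gamma>"
    using assms(1) by blast
  then have AM: "A \<in> Max_Crit_Ind G" and AC: "A \<in> Crit_Ind G"
    using assms(2) by (auto simp: Max_Crit_Ind_def)
  have \<Gamma>: "\<And>B. B \<in> \<Gamma> \<Longrightarrow> B \<in> Crit_Ind G" and \<Gamma>I: "\<And>B. B \<in> \<Gamma> \<Longrightarrow> B \<in> Ind G"
    using assms(2) by (auto simp: Max_Crit_Ind_def Crit_Ind_iff)
  have "\<Union>\<Gamma> \<subseteq> verts G"
    using \<Gamma>I Ind_subset_verts by blast
  then have fin: "finite A" "finite (\<Union>\<Gamma>)"
    using finite_Ind_member[OF \<Gamma>I[OF A]] finite_subset[OF _ finite_verts] by simp_all
  have "\<Union>\<Gamma> - A \<subseteq> neighborhood G A"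
    using Crit_Ind_subset_closed_neighborhood[OF AM] \<Gamma> by blast
  then have "card (\<Union>\<Gamma> - A) \<le> card (A \<inter> neighborhood G (\<Union>\<Gamma> - A))"
    by (rule critical_Hall[OF AC])
  \<comment> \<open>A vertex of \<open>A\<close> with a neighbor in some member of
    \<open>\<Gamma>\<close> is missing from that independent member, hence from the
    intersection.\<close>
  also have "\<dots> \<le> card (A - \<Inter>\<Gamma>)"
    using \<Gamma>I fin by (intro card_mono) (auto simp: neighborhood_def Ind_def)
  also have "\<dots> = card A - card (\<Inter>\<Gamma>)"
    using A fin by (intro card_Diff_subset) (auto intro: finite_subset[of "\<Inter>\<Gamma>" A])
  finally have "card (\<Union>\<Gamma> - A) \<le> card A - card (\<Inter>\<Gamma>)" .
  moreover have "card (\<Union>\<Gamma>) = card A + card (\<Union>\<Gamma> - A)"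
    using A fin card_Int_Diff[OF fin(2), of A] by (simp add: Int_absorb1 Union_upper)
  moreover have "card (\<Inter>\<Gamma>) \<le> card A"
    using A fin by (intro card_mono) auto
  ultimately show ?thesis
    using crit_indep_number_eq_card[OF AM] by linarith
qed

lemma card_Inter_Union_Max_Ind:
  assumes "finite \<Gamma>" "\<Gamma> \<noteq> {}" "\<Gamma> \<subseteq> Max_Ind G"
  shows "2 * indep_number G \<le> card (\<Inter>\<Gamma>) + card (\<Union>\<Gamma>)"
  using assms
proof (induction \<Gamma> rule: finite_ne_induct)
  case (singleton S)
  then show ?case
    by (simp add: indep_number_eq_card)
next
  case (insert T \<Gamma>)
  let ?I = "\<Inter>\<Gamma>" and ?U = "\<Union>\<Gamma>"
  have T: "T \<in> Ind G" and \<Gamma>: "\<And>S. S \<in> \<Gamma> \<Longrightarrow> S \<in> Ind G"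
    using insert.prems by (auto simp: Max_Ind_def)
  have IU: "?I \<subseteq> ?U"
    using insert.hyps by auto
  have "?U \<subseteq> verts G"
    using \<Gamma> Ind_subset_verts by blast
  then have fin: "finite T" "finite ?U"
    using finite_Ind_member[OF T] finite_subset[OF _ finite_verts] by simp_all
  have "finite ?I"
    using IU fin(2) by (rule finite_subset)
  have indep: "(T \<inter> ?U) \<union> ?I \<in> Ind G"
  proof -
    have sub: "(T \<inter> ?U) \<union> ?I \<subseteq> verts G"
      using IU \<open>?U \<subseteq> verts G\<close> by blast
    \<comment> \<open>Some member of \<open>\<Gamma>\<close> contains \<open>v\<close>, and every
      member contains \<open>u\<close>.\<close>
    have nonadj: "\<not> u \<rightarrow>\<^bsub>G\<^esub> v \<and> \<not> v \<rightarrow>\<^bsub>G\<^esub> u" if "u \<in> ?I" "v \<in> ?U" for u v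
      using that \<Gamma> unfolding Ind_def by blast
    have "\<not> u \<rightarrow>\<^bsub>G\<^esub> v" if "u \<in> (T \<inter> ?U) \<union> ?I" "v \<in> (T \<inter> ?U) \<union> ?I" for u v
    proof (cases "u \<in> T \<and> v \<in> T")
      case True
      then show ?thesis
        using T by (simp add: Ind_def)
    next
      case False
      then have "u \<in> ?I \<or> v \<in> ?I" "u \<in> ?U" "v \<in> ?U"
        using that IU by blast+
      then show ?thesis
        using nonadj by blast
    qed
    then show ?thesis
      using sub by (simp add: Ind_def)
  qed
  \<comment> \<open>The exchanged set is written as a disjoint union so that its cardinality
    splits.\<close>
  have "card ((T \<inter> ?U) \<union> (?I - T)) \<le> card T"
  proof -
    have "(T \<inter> ?U) \<union> (?I - T) = (T \<inter> ?U) \<union> ?I"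
      using IU by blast
    then show ?thesis
      using insert.prems indep by (simp add: Max_Ind_def)
  qed
  then have "card (T \<inter> ?U) + card (?I - T) \<le> card T"
    using fin \<open>finite ?I\<close> by (subst (asm) card_Un_disjoint) auto
  moreover have "card (?U \<union> T) + card (T \<inter> ?U) = card ?U + card T"
    using card_Un_Int[OF fin(2,1)] by (simp add: Int_commute)
  moreover have "card ?I = card (?I \<inter> T) + card (?I - T)"
    using card_Int_Diff[OF \<open>finite ?I\<close>] .
  \<comment> \<open>Adjoining \<open>T\<close> shrinks the intersection by |?I - T| and enlarges the
    union by |T| - |T \<inter> ?U|, which is at least as much.\<close>
  ultimately have "card ?I + card ?U \<le> card (?I \<inter> T) + card (?U \<union> T)"
    by linarith
  then show ?case
    using insert.IH insert.prems by (simp add: Int_commute Un_commute)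
qed

lemma crit_indep_number_le_indep_number:
  assumes "A \<in> Max_Crit_Ind G"
  shows "crit_indep_number G \<le> indep_number G"
proof -
  have "A \<in> Ind G"
    using assms by (simp add: Max_Crit_Ind_def Crit_Ind_def)
  then show ?thesis
    unfolding crit_indep_number_eq_card[OF assms] indep_number_def
    using finite_Ind by simp
qed

end

theorem theorem2p3:
  fixes G :: "('a, 'b) pre_digraph"
    and \<Gamma>' \<Gamma> :: "'a set set"
  assumes "graph G"
    and "\<Gamma>' \<noteq> {}" and "\<Gamma>' \<subseteq> Max_Crit_Ind G"
    and "\<Gamma> \<noteq> {}" and "\<Gamma> \<subseteq> Max_Ind G"
  shows "card (\<Inter>\<Gamma>') + card (\<Union>\<Gamma>') \<le> 2 * crit_indep_number G
    \<and> 2 * crit_indep_number G \<le> 2 * indep_number G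
    \<and> 2 * indep_number G \<le> card (\<Inter>\<Gamma>) + card (\<Union>\<Gamma>)"
proof -
  interpret graph G
    by (rule assms(1))
  \<comment> \<open>The lower bound is proved by induction over finite families.\<close>
  have "finite \<Gamma>"
    using assms(5) finite_Ind by (auto simp: Max_Ind_def intro: finite_subset[of \<Gamma> "Ind G"])
  moreover obtain A where "A \<in> Max_Crit_Ind G"
    using assms(2,3) by blast
  ultimately show ?thesis
    using assms card_Inter_Union_Max_Crit_Ind card_Inter_Union_Max_Ind
      crit_indep_number_le_indep_number by simp
qed

end
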